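(* Let $A \in M_n(\mathbb{C})$ with $\mathrm{rank}(A)=r>0$ be written in a Hartwig-Spindelböck decomposition $$A = U \begin{pmatrix} \Sigma Q & \Sigma P \\ 0 & 0\end{pmatrix} U^{*},$$ and let $\tilde{\Sigma} = Q(\Sigma Q)^{d}\,((\Sigma Q)^{d})^{2}$. Then the Moore-Penrose inverse of the MPDMP matrix $A^{\dagger,d,\dagger}$ is $$(A^{\dagger,d,\dagger})^{\dagger} = U \begin{pmatrix} \tilde{\Sigma}^{\dagger}Q & \tilde{\Sigma}^{\dagger}P \\ 0 & 0\end{pmatrix} U^{*}.$$
   Context: $M^{\dagger}$ is the Moore-Penrose inverse and $M^{d}$ the Drazin inverse of a (square) matrix $M$. The MPDMP matrix associated with $A$ is $A^{\dagger,d,\dagger} := A^{\dagger}A^{d}A^{\dagger}$. In a Hartwig-Spindelböck decomposition of a matrix $A\in M_n(\mathbb{C})$ of rank $r>0$, $U\in M_n(\mathbb{C})$ is unitary, $\Sigma = \mathrm{diag}(\sigma_1 I_{k_1},\dots,\sigma_t I_{k_t})\in M_r(\mathbb{C})$ is diagonal with the nonzero singular values $\sigma_j>0$ of $A$ on the diagonal ($k_1+\dots+k_t=r$), and $Q\in M_r(\mathbb{C})$, $P\in M_{r,n-r}(\mathbb{C})$ satisfy $QQ^{*}+PP^{*}=I_r$. Every nonzero matrix has such a decomposition. *)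

theory Defs
  imports
    "Jordan_Normal_Form.Schur_Decomposition"
    "Jordan_Normal_Form.DL_Rank"
    "HOL-Computational_Algebra.Fundamental_Theorem_Algebra"
begin

definition unitary_mat :: "nat \<Rightarrow> complex mat \<Rightarrow> bool" where
  "unitary_mat n U \<longleftrightarrow>
     U \<in> carrier_mat n n \<and> mat_adjoint U * U = 1\<^sub>m n \<and> U * mat_adjoint U = 1\<^sub>m n"

definition is_moore_penrose :: "complex mat \<Rightarrow> complex mat \<Rightarrow> bool" where
  "is_moore_penrose A X \<longleftrightarrow>
     X \<in> carrier_mat (dim_col A) (dim_row A) \<and>
     A * X * A = A \<and>
     X * A * X = X \<and>
     mat_adjoint (A * X) = A * X \<and>
     mat_adjoint (X * A) = X * A"

definition moore_penrose :: "complex mat \<Rightarrow> complex mat" where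
  "moore_penrose A = (THE X. is_moore_penrose A X)"

(* Drazin's definition. The last condition holds for some k iff it holds for k = ind(A),
   the least k with rank (A^k) = rank (A^(k+1)). Intended for square A only. *)
definition is_drazin :: "complex mat \<Rightarrow> complex mat \<Rightarrow> bool" where
  "is_drazin A X \<longleftrightarrow>
     X \<in> carrier_mat (dim_row A) (dim_row A) \<and>
     A * X = X * A \<and>
     X * A * X = X \<and>
     (\<exists>k. A ^\<^sub>m (Suc k) * X = A ^\<^sub>m k)"

definition drazin :: "complex mat \<Rightarrow> complex mat" where
  "drazin A = (THE X. is_drazin A X)"

definition mpdmp :: "complex mat \<Rightarrow> complex mat" where
  "mpdmp A = moore_penrose A * drazin A * moore_penrose A"

(* Square roots of the eigenvalues of A^* A, with multiplicity; these eigenvalues are real and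
   nonnegative, so taking the real part loses nothing. *)
definition singular_values :: "complex mat \<Rightarrow> real multiset" where
  "singular_values A = image_mset (\<lambda>x. sqrt (Re x)) (proots (char_poly (mat_adjoint A * A)))"

(* S = diag(s_1 I_{k_1}, ..., s_t I_{k_t}), given by the list [(s_1, k_1), ..., (s_t, k_t)]; its
   diagonal lists the nonzero singular values of A with multiplicity. The s_j are not required
   to be distinct. *)
definition is_singular_value_diag :: "complex mat \<Rightarrow> nat \<Rightarrow> complex mat \<Rightarrow> bool" where
  "is_singular_value_diag A r S \<longleftrightarrow>
     (\<exists>sks :: (real \<times> nat) list.
        (\<forall>(s, k) \<in> set sks. s > 0 \<and> k > 0) \<and>
        sum_list (map snd sks) = r \<and>
        S = diag_block_mat (map (\<lambda>(s, k). complex_of_real s \<cdot>\<^sub>m 1\<^sub>m k) sks) \<and>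
        mset (concat (map (\<lambda>(s, k). replicate k s) sks)) =
          filter_mset (\<lambda>s. s \<noteq> 0) (singular_values A))"

definition hartwig_spindelboeck ::
  "nat \<Rightarrow> nat \<Rightarrow> complex mat \<Rightarrow> complex mat \<Rightarrow> complex mat \<Rightarrow> complex mat \<Rightarrow> complex mat \<Rightarrow> bool"
where
  "hartwig_spindelboeck n r A U S Q P \<longleftrightarrow>
     unitary_mat n U \<and>
     is_singular_value_diag A r S \<and>
     Q \<in> carrier_mat r r \<and>
     P \<in> carrier_mat r (n - r) \<and>
     Q * mat_adjoint Q + P * mat_adjoint P = 1\<^sub>m r \<and>
     A = U * four_block_mat (S * Q) (S * P) (0\<^sub>m (n - r) r) (0\<^sub>m (n - r) (n - r)) * mat_adjoint U"

lemma mat_adjoint_dim [simp]: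
  "dim_row (mat_adjoint A) = dim_col A" "dim_col (mat_adjoint A) = dim_row A"
  by (auto simp: mat_adjoint_def)

lemma mat_adjoint_index [simp]:
  "i < dim_col A \<Longrightarrow> j < dim_row A \<Longrightarrow> mat_adjoint A $$ (i, j) = conjugate (A $$ (j, i))"
  by (auto simp: mat_adjoint_def mat_of_rows_def)

lemma mat_adjoint_mult:
  fixes A B :: "complex mat"
  assumes "A \<in> carrier_mat a b" "B \<in> carrier_mat b c"
  shows "mat_adjoint (A * B) = mat_adjoint B * mat_adjoint A"
  by (rule eq_matI) (use assms in \<open>auto simp: scalar_prod_def mult.commute intro!: sum.cong\<close>)

lemma is_moore_penrose_unique:
  assumes "is_moore_penrose A X" "is_moore_penrose A Y"
  shows "X = Y"
proof -
  define m n where "m = dim_row A" and "n = dim_col A"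
  have A: "A \<in> carrier_mat m n" by (auto simp: m_def n_def)
  have X: "X \<in> carrier_mat n m" and Y: "Y \<in> carrier_mat n m"
    using assms by (auto simp: is_moore_penrose_def m_def n_def)
  have x: "A * X * A = A" "X * A * X = X" "mat_adjoint (A * X) = A * X" "mat_adjoint (X * A) = X * A"
    and y: "A * Y * A = A" "Y * A * Y = Y" "mat_adjoint (A * Y) = A * Y" "mat_adjoint (Y * A) = Y * A"
    using assms by (auto simp: is_moore_penrose_def)
  have AX: "A * X \<in> carrier_mat m m" and AY: "A * Y \<in> carrier_mat m m"
    and XA: "X * A \<in> carrier_mat n n" and YA: "Y * A \<in> carrier_mat n n"
    using A X Y by auto
  have "A * X = A * Y * A * X" using y(1) by simp
  also have "\<dots> = (A * Y) * (A * X)" by (rule assoc_mult_mat[OF AY A X])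
  also have "\<dots> = mat_adjoint ((A * X) * (A * Y))"
    by (simp add: mat_adjoint_mult[OF AX AY] x y)
  also have "(A * X) * (A * Y) = A * X * A * Y" using assoc_mult_mat[OF AX A Y] by simp
  finally have 1: "A * X = A * Y" using x y by simp
  have "X * A = X * (A * Y * A)" using y(1) by simp
  also have "\<dots> = (X * A) * (Y * A)"
    using assoc_mult_mat[OF A Y A] assoc_mult_mat[OF X A YA] by simp
  also have "\<dots> = mat_adjoint ((Y * A) * (X * A))"
    by (simp add: mat_adjoint_mult[OF YA XA] x y)
  also have "(Y * A) * (X * A) = Y * (A * X * A)"
    using assoc_mult_mat[OF A X A] assoc_mult_mat[OF Y A XA] by simp
  finally have 2: "X * A = Y * A" using x y by simp
  have "X = X * A * X" using x by simp
  also have "\<dots> = Y * (A * X)" using 2 assoc_mult_mat[OF Y A X] by simp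
  also have "\<dots> = Y * A * Y" using 1 assoc_mult_mat[OF Y A Y] by simp
  finally show ?thesis using y by simp
qed

lemma moore_penrose_eqI: "is_moore_penrose A X \<Longrightarrow> moore_penrose A = X"
  unfolding moore_penrose_def using is_moore_penrose_unique by blast

lemma commuting_outer_inverse_pow:
  fixes A X :: "complex mat"
  assumes A: "A \<in> carrier_mat n n" and X: "X \<in> carrier_mat n n"
    and c: "A * X = X * A" and o: "X * A * X = X"
  shows "X ^\<^sub>m (Suc k) * A ^\<^sub>m k = X \<and> A ^\<^sub>m k * X ^\<^sub>m (Suc k) = X"
proof (induction k)
  case 0
  show ?case using A X by auto
next
  case (Suc k)
  have Ak: "A ^\<^sub>m k \<in> carrier_mat n n" and Xk: "X ^\<^sub>m k \<in> carrier_mat n n"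
    and XSk: "X ^\<^sub>m Suc k \<in> carrier_mat n n" and XA: "X * A \<in> carrier_mat n n"
    using A X by (auto simp del: pow_mat.simps)
  have XXA: "X * (X * A) = X"
    using o assoc_mult_mat[OF X A X] c by simp
  have comm: "A ^\<^sub>m j * A = A * A ^\<^sub>m j" for j
  proof (induction j)
    case (Suc j)
    have Aj: "A ^\<^sub>m j \<in> carrier_mat n n" using A by auto
    show ?case using Suc assoc_mult_mat[OF A Aj A] by simp
  qed (use A in auto)
  have "X ^\<^sub>m Suc (Suc k) * A ^\<^sub>m Suc k = X ^\<^sub>m Suc k * X * (A * A ^\<^sub>m k)"
    using comm by simp
  also have "\<dots> = X ^\<^sub>m k * (X * (X * A)) * A ^\<^sub>m k"
    using A X Ak Xk by (simp add: assoc_mult_mat[of _ n n _ n _ n])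
  also have "\<dots> = X" using XXA Suc by simp
  finally have 1: "X ^\<^sub>m Suc (Suc k) * A ^\<^sub>m Suc k = X" .
  have commX: "X ^\<^sub>m j * X = X * X ^\<^sub>m j" for j
  proof (induction j)
    case (Suc j)
    have Xj: "X ^\<^sub>m j \<in> carrier_mat n n" using X by auto
    show ?case using Suc assoc_mult_mat[OF X Xj X] by simp
  qed (use X in auto)
  have AXX: "A * X * X = X" using o c by simp
  have "A ^\<^sub>m Suc k * X ^\<^sub>m Suc (Suc k) = A ^\<^sub>m k * A * (X * (X * X ^\<^sub>m k))"
    using commX assoc_mult_mat[OF X Xk X] by simp
  also have "\<dots> = A ^\<^sub>m k * (A * X * X * X ^\<^sub>m k)"
    using A X Ak Xk by (simp add: assoc_mult_mat[of _ n n _ n _ n])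
  also have "\<dots> = A ^\<^sub>m k * X ^\<^sub>m Suc k" using AXX commX by simp
  also have "\<dots> = X" using Suc by simp
  finally show ?case using 1 by simp
qed

lemma is_drazin_pow_mono:
  fixes A X :: "complex mat"
  assumes A: "A \<in> carrier_mat n n" and X: "X \<in> carrier_mat n n"
    and k: "A ^\<^sub>m (Suc k) * X = A ^\<^sub>m k" and kj: "k \<le> j" and c: "A * X = X * A"
  shows "A ^\<^sub>m (Suc j) * X = A ^\<^sub>m j"
  using kj
proof (induction j rule: dec_induct)
  case (step j)
  have Aj: "A ^\<^sub>m j \<in> carrier_mat n n" and ASj: "A ^\<^sub>m Suc j \<in> carrier_mat n n"
    using A by (auto simp del: pow_mat.simps)
  have "A ^\<^sub>m Suc (Suc j) * X = A ^\<^sub>m Suc j * (A * X)"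
    using assoc_mult_mat[OF ASj A X] by simp
  also have "\<dots> = A ^\<^sub>m Suc j * X * A" using c assoc_mult_mat[OF ASj X A] by simp
  finally show ?case using step by simp
qed (use k in simp)

lemma is_drazin_unique:
  assumes sq: "square_mat A" and dX: "is_drazin A X" and dY: "is_drazin A Y"
  shows "X = Y"
proof -
  define n where "n = dim_row A"
  have A: "A \<in> carrier_mat n n" using sq by (auto simp: n_def)
  have X: "X \<in> carrier_mat n n" and Y: "Y \<in> carrier_mat n n"
    and c: "A * X = X * A" "A * Y = Y * A" and o: "X * A * X = X" "Y * A * Y = Y"
    using dX dY by (auto simp: is_drazin_def n_def)
  obtain k l where "A ^\<^sub>m (Suc k) * X = A ^\<^sub>m k" "A ^\<^sub>m (Suc l) * Y = A ^\<^sub>m l"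
    using dX dY by (auto simp: is_drazin_def simp del: pow_mat.simps)
  then have kX: "A ^\<^sub>m (Suc (max k l)) * X = A ^\<^sub>m (max k l)"
    and kY: "A ^\<^sub>m (Suc (max k l)) * Y = A ^\<^sub>m (max k l)"
    using is_drazin_pow_mono[OF A X _ _ c(1)] is_drazin_pow_mono[OF A Y _ _ c(2)]
    by (metis max.cobounded1, metis max.cobounded2)
  define m where "m = max k l"
  have Am: "A ^\<^sub>m m \<in> carrier_mat n n" and Xm: "X ^\<^sub>m Suc m \<in> carrier_mat n n"
    and Ym: "Y ^\<^sub>m Suc m \<in> carrier_mat n n"
    using A X Y by (auto simp del: pow_mat.simps)
  have commXpow: "X * A ^\<^sub>m j = A ^\<^sub>m j * X" for j
  proof (induction j)
    case (Suc j)
    have Aj: "A ^\<^sub>m j \<in> carrier_mat n n" using A by auto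
    have "X * A ^\<^sub>m Suc j = X * A ^\<^sub>m j * A" using assoc_mult_mat[OF X Aj A] by simp
    also have "\<dots> = A ^\<^sub>m j * (A * X)" using Suc c assoc_mult_mat[OF Aj X A] by simp
    finally show ?case using assoc_mult_mat[OF Aj A X] by simp
  qed (use A X in auto)
  have commApow: "A * A ^\<^sub>m j = A ^\<^sub>m j * A" for j
  proof (induction j)
    case (Suc j)
    have Aj: "A ^\<^sub>m j \<in> carrier_mat n n" using A by auto
    show ?case using Suc assoc_mult_mat[OF A Aj A] by simp
  qed (use A in auto)
  have XA: "X * A \<in> carrier_mat n n" and AY: "A * Y \<in> carrier_mat n n" using A X Y by auto
  have "X * A * A ^\<^sub>m m = A ^\<^sub>m m * (A * X)"
    using commXpow[of m] c(1) assoc_mult_mat[OF A X Am] assoc_mult_mat[OF A Am X]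
      assoc_mult_mat[OF Am A X] commApow[of m] by simp
  then have XAm: "X * A * A ^\<^sub>m m = A ^\<^sub>m m"
    using kX assoc_mult_mat[OF Am A X] by (simp add: m_def)
  have AmY: "A ^\<^sub>m m * (A * Y) = A ^\<^sub>m m"
    using kY assoc_mult_mat[OF Am A Y] by (simp add: m_def)
  have "X = X ^\<^sub>m Suc m * A ^\<^sub>m m"
    using commuting_outer_inverse_pow[OF A X c(1) o(1), of m] by simp
  also have "\<dots> = X ^\<^sub>m Suc m * A ^\<^sub>m m * (A * Y)"
    using AmY assoc_mult_mat[OF Xm Am AY] by simp
  also have "\<dots> = X * (A * Y)"
    using commuting_outer_inverse_pow[OF A X c(1) o(1), of m] by simp
  also have "\<dots> = X * A * Y" using assoc_mult_mat[OF X A Y] by simp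
  also have "\<dots> = X * A * (A ^\<^sub>m m * Y ^\<^sub>m Suc m)"
    using commuting_outer_inverse_pow[OF A Y c(2) o(2), of m] by simp
  also have "\<dots> = A ^\<^sub>m m * Y ^\<^sub>m Suc m"
    using XAm assoc_mult_mat[OF XA Am Ym] by simp
  also have "\<dots> = Y"
    using commuting_outer_inverse_pow[OF A Y c(2) o(2), of m] by simp
  finally show ?thesis .
qed

lemma drazin_eqI: "square_mat A \<Longrightarrow> is_drazin A X \<Longrightarrow> drazin A = X"
  unfolding drazin_def using is_drazin_unique by blast

end

theory Submission
  imports Defs "Jordan_Normal_Form.Jordan_Normal_Form_Existence"
begin

text \<open>The decomposition factors \<open>A\<close> as \<open>E \<Sigma> W\<close>, where \<open>E\<close> and \<open>W\<^sup>*\<close> are isometries and \<open>W E = Q\<close>.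
  Isometries pass through the Moore-Penrose inverse, so \<open>A\<^sup>\<dagger> = W\<^sup>* \<Sigma>\<^sup>-\<^sup>1 E\<^sup>*\<close>. With \<open>D = (\<Sigma> Q)\<^sup>d\<close>, Cline's
  formula gives \<open>A\<^sup>d = E D\<^sup>2 \<Sigma> W\<close>. Hence \<open>A\<^sup>\<dagger> A\<^sup>d A\<^sup>\<dagger> = W\<^sup>* \<Sigma>\<^sup>-\<^sup>1 D\<^sup>2 E\<^sup>* = W\<^sup>* \<Sigma>' E\<^sup>*\<close>, because
  \<open>D = \<Sigma> Q D\<^sup>2\<close>, and the Moore-Penrose inverse of this is \<open>E \<Sigma>'\<^sup>\<dagger> W\<close>.\<close>

text \<open>Conditions on dimensions instead of carriers leave no size variables to guess, so the
  simplifier can discharge them and reassociate products to the right.\<close>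

lemma mult_mat_assoc:
  fixes A B C :: "'a::semiring_0 mat"
  assumes "dim_col A = dim_row B" "dim_col B = dim_row C"
  shows "A * B * C = A * (B * C)"
  using assms by (intro assoc_mult_mat[of _ "dim_row A" "dim_col A" _ "dim_col B" _ "dim_col C"]) auto

lemma mat_adjoint_mult_dim:
  fixes A B :: "complex mat"
  assumes "dim_col A = dim_row B"
  shows "mat_adjoint (A * B) = mat_adjoint B * mat_adjoint A"
  using assms by (intro mat_adjoint_mult[of _ "dim_row A" "dim_col A" _ "dim_col B"]) auto

lemma mat_adjoint_adjoint [simp]: "mat_adjoint (mat_adjoint A) = (A :: complex mat)"
  by (rule eq_matI) auto

lemma mat_adjoint_one [simp]: "mat_adjoint (1\<^sub>m n) = (1\<^sub>m n :: complex mat)"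
  by (rule eq_matI) auto

lemma mat_adjoint_zero [simp]: "mat_adjoint (0\<^sub>m m n) = (0\<^sub>m n m :: complex mat)"
  by (rule eq_matI) auto

lemma mat_adjoint_four_block_mat:
  fixes A B C D :: "complex mat"
  assumes "A \<in> carrier_mat m1 n1" "B \<in> carrier_mat m1 n2"
    "C \<in> carrier_mat m2 n1" "D \<in> carrier_mat m2 n2"
  shows "mat_adjoint (four_block_mat A B C D) =
    four_block_mat (mat_adjoint A) (mat_adjoint C) (mat_adjoint B) (mat_adjoint D)"
  by (rule eq_matI) (use assms in auto)

lemma pow_mat_commute:
  fixes A X :: "'a::semiring_1 mat"
  assumes A: "A \<in> carrier_mat n n" and X: "X \<in> carrier_mat n n" and c: "A * X = X * A"
  shows "A ^\<^sub>m j * X = X * A ^\<^sub>m j"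
proof (induction j)
  case (Suc j)
  have "A ^\<^sub>m Suc j * X = A ^\<^sub>m j * X * A"
    using A X c by (simp add: mult_mat_assoc)
  also have "\<dots> = X * A ^\<^sub>m Suc j"
    unfolding Suc using A X by (simp add: mult_mat_assoc)
  finally show ?case .
qed (use A X in auto)

lemma pow_mat_Suc_left:
  fixes A :: "'a::semiring_1 mat"
  assumes "A \<in> carrier_mat n n"
  shows "A ^\<^sub>m Suc j = A * A ^\<^sub>m j"
  using pow_mat_commute[OF assms assms refl] by simp

section \<open>Existence of the Drazin inverse\<close>

text \<open>Regrouping the alternating product carries power identities from \<open>G * F\<close>
  over to \<open>F * G\<close>, at the price of one extra exponent.\<close>

lemma pow_mat_mult_swap:
  fixes F G :: "'a::semiring_1 mat"
  assumes F: "F \<in> carrier_mat n m" and G: "G \<in> carrier_mat m n"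
  shows "(F * G) ^\<^sub>m Suc j = F * ((G * F) ^\<^sub>m j * G)"
proof (induction j)
  case 0
  show ?case using F G by simp
next
  case (Suc j)
  have "(F * G) ^\<^sub>m Suc (Suc j) = F * ((G * F) ^\<^sub>m j * G) * (F * G)"
    using Suc by simp
  also have "\<dots> = F * ((G * F) ^\<^sub>m j * (G * F) * G)"
    using F G by (simp add: mult_mat_assoc)
  finally show ?case by simp
qed

text \<open>Cline's formula.\<close>
lemma is_drazin_mult_swap:
  assumes F: "F \<in> carrier_mat n m" and G: "G \<in> carrier_mat m n" and D: "is_drazin (G * F) D"
  shows "is_drazin (F * G) (F * (D * (D * G)))"
proof -
  define B where "B = G * F"
  have B: "B \<in> carrier_mat m m" using F G by (simp add: B_def)
  \<comment> \<open>The trailing \<open>Z\<close> lets this rule, and \<open>DBD\<close> and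
    \<open>BDD\<close> below, fire inside right-nested products.\<close>
  have GF: "G * (F * Z) = B * Z" if "dim_row Z = m" for Z
    using F G that by (simp add: B_def mult_mat_assoc)
  have Dc: "D \<in> carrier_mat m m" and c: "B * D = D * B" and o: "D * B * D = D"
    using D F G by (auto simp: is_drazin_def B_def)
  obtain k where k: "B ^\<^sub>m Suc k * D = B ^\<^sub>m k"
    using D unfolding is_drazin_def B_def by blast
  have dims [simp]: "dim_row F = n" "dim_col F = m" "dim_row G = m" "dim_col G = n"
    "dim_row D = m" "dim_col D = m" "dim_row B = m" "dim_col B = m"
    using F G Dc B by auto
  have DBD: "D * (B * Z) = B * (D * Z)" if "dim_row Z = m" for Z
    using that c by (simp flip: mult_mat_assoc)
  have BDD: "B * (D * (D * Z)) = D * Z" if "dim_row Z = m" for Z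
    using that c o by (simp flip: mult_mat_assoc)
  have l: "F * G * (F * (D * (D * G))) = F * (D * G)"
    by (simp add: mult_mat_assoc GF BDD)
  have r: "F * (D * (D * G)) * (F * G) = F * (D * G)"
    by (simp add: mult_mat_assoc GF DBD BDD)
  \<comment> \<open>The Drazin exponent rises from \<open>k\<close> to \<open>Suc k\<close>, since
    the swap uses up one factor \<open>F * G\<close>.\<close>
  have "(F * G) ^\<^sub>m Suc (Suc k) * (F * (D * (D * G))) = (F * G) ^\<^sub>m Suc k * (F * (D * G))"
    using l by (simp add: mult_mat_assoc)
  also have "\<dots> = F * (B ^\<^sub>m k * G) * (F * (D * G))"
    by (simp only: pow_mat_mult_swap[OF F G] B_def)
  also have "\<dots> = F * (B ^\<^sub>m Suc k * D * G)"
    by (simp add: mult_mat_assoc GF)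
  also have "\<dots> = (F * G) ^\<^sub>m Suc k"
    unfolding k by (simp only: pow_mat_mult_swap[OF F G] B_def)
  finally have p: "(F * G) ^\<^sub>m Suc (Suc k) * (F * (D * (D * G))) = (F * G) ^\<^sub>m Suc k" .
  have "F * (D * (D * G)) * (F * G) * (F * (D * (D * G))) = F * (D * (D * G))"
    unfolding r by (simp add: mult_mat_assoc GF BDD)
  then show ?thesis
    unfolding is_drazin_def using l r p by (auto intro!: exI[of _ "Suc k"] simp del: pow_mat.simps)
qed

lemma is_drazin_four_block_diag:
  assumes A: "A \<in> carrier_mat m m" and B: "B \<in> carrier_mat n n"
    and X: "is_drazin A X" and Y: "is_drazin B Y"
  shows "is_drazin (four_block_mat A (0\<^sub>m m n) (0\<^sub>m n m) B) (four_block_mat X (0\<^sub>m m n) (0\<^sub>m n m) Y)"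
proof -
  have Xc: "X \<in> carrier_mat m m" and Yc: "Y \<in> carrier_mat n n"
    and c: "A * X = X * A" "B * Y = Y * B" and o: "X * A * X = X" "Y * B * Y = Y"
    using X Y A B by (auto simp: is_drazin_def)
  obtain k l where "A ^\<^sub>m Suc k * X = A ^\<^sub>m k" "B ^\<^sub>m Suc l * Y = B ^\<^sub>m l"
    using X Y unfolding is_drazin_def by blast
  \<comment> \<open>The blocks may come with different exponents; both identities persist at the
    maximum.\<close>
  then have p: "A ^\<^sub>m Suc (max k l) * X = A ^\<^sub>m max k l" "B ^\<^sub>m Suc (max k l) * Y = B ^\<^sub>m max k l"
    using is_drazin_pow_mono[OF A Xc _ _ c(1)] is_drazin_pow_mono[OF B Yc _ _ c(2)]
    by (metis max.cobounded1, metis max.cobounded2)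
  let ?D = "\<lambda>A B. four_block_mat A (0\<^sub>m m n) (0\<^sub>m n m) B"
  have mult: "?D M N * ?D M' N' = ?D (M * M') (N * N')"
    if "M \<in> carrier_mat m m" "M' \<in> carrier_mat m m" "N \<in> carrier_mat n n" "N' \<in> carrier_mat n n"
    for M M' N N' :: "complex mat"
    using that by (subst mult_four_block_mat[of _ m m _ n _ n _ _ m _ n]) auto
  have "?D A B ^\<^sub>m Suc (max k l) * ?D X Y = ?D A B ^\<^sub>m max k l"
    unfolding pow_four_block_mat[OF A B] using A B Xc Yc p
    by (subst mult) (auto simp del: pow_mat.simps intro!: pow_carrier_mat)
  then show ?thesis
    unfolding is_drazin_def using A B Xc Yc c o
    by (auto simp: mult simp del: pow_mat.simps)
qed

text \<open>For eigenvalue 0 the block is nilpotent and 0 serves; otherwise the triangular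
  determinant is nonzero and the ordinary inverse serves, with exponent 0.\<close>

lemma ex_drazin_jordan_block: "\<exists>X. is_drazin (jordan_block n a) X"
proof (cases "a = 0")
  case True
  have "jordan_block n (0::complex) ^\<^sub>m n = 0\<^sub>m n n"
    unfolding jordan_block_zero_pow by (rule eq_matI) auto
  then have "is_drazin (jordan_block n a) (0\<^sub>m n n)"
    unfolding is_drazin_def using True
    by (auto intro!: exI[of _ n] simp: left_mult_zero_mat[of _ n n] right_mult_zero_mat[of _ n n])
  then show ?thesis by blast
next
  case False
  let ?J = "jordan_block n a"
  have "det ?J = prod_list (diag_mat ?J)"
    by (rule det_upper_triangular[of _ n]) auto
  then have "det ?J \<noteq> 0"
    using False by (auto simp: prod_list_zero_iff diag_mat_def)
  from det_non_zero_imp_unit[OF jordan_block_carrier this, of n]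
  obtain X where X: "X \<in> carrier_mat n n" "X * ?J = 1\<^sub>m n" "?J * X = 1\<^sub>m n"
    by (auto simp: Units_def ring_mat_def)
  then have "is_drazin ?J X"
    unfolding is_drazin_def by (auto intro!: exI[of _ 0])
  then show ?thesis by blast
qed

lemma ex_drazin_jordan_matrix: "\<exists>X. is_drazin (jordan_matrix n_as) X"
proof (induction n_as)
  case Nil
  have "jordan_matrix [] = (0\<^sub>m 0 0 :: complex mat)"
    by (simp add: jordan_matrix_def)
  then have "is_drazin (jordan_matrix []) (0\<^sub>m 0 0)"
    by (auto simp: is_drazin_def intro!: exI[of _ 0])
  then show ?case by blast
next
  case (Cons p n_as)
  obtain n a where p: "p = (n, a)" by force
  show ?case
    using Cons ex_drazin_jordan_block is_drazin_four_block_diag[OF jordan_block_carrier jordan_matrix_carrier]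
    unfolding p jordan_matrix_Cons by blast
qed

text \<open>Characteristic polynomials split over the complex numbers, so a Jordan form exists and
  its Drazin inverse can be carried back; uniqueness then identifies it with the definite
  description.\<close>

lemma is_drazin_drazin:
  assumes A: "A \<in> carrier_mat n n"
  shows "is_drazin A (drazin A)"
proof -
  obtain n_as where "jordan_nf A n_as"
    using char_poly_factorized[OF A] jordan_nf_exists[OF A] by blast
  then obtain F G where w: "similar_mat_wit A (jordan_matrix n_as) F G"
    by (auto simp: jordan_nf_def similar_mat_def)
  let ?J = "jordan_matrix n_as"
  note w' = similar_mat_witD2[OF A w]
  \<comment> \<open>Similarity becomes an instance of Cline's formula: swapping the factors
    \<open>F\<close> and \<open>?J * G\<close> turns \<open>A\<close> into \<open>?J\<close>,
    because \<open>G * F\<close> is the identity.\<close>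
  have A': "A = F * (?J * G)" and J: "(?J * G) * F = ?J"
    using w' by (auto simp: mult_mat_assoc)
  obtain X where "is_drazin (?J * G * F) X"
    using ex_drazin_jordan_matrix unfolding J by blast
  from is_drazin_mult_swap[OF w'(6) mult_carrier_mat[OF w'(5,7)] this]
  obtain Y where "is_drazin A Y" unfolding A' by blast
  then show ?thesis
    using drazin_eqI[of A Y] A by auto
qed

section \<open>Existence of the Moore-Penrose inverse\<close>

text \<open>The j-th diagonal entry of \<open>mat_adjoint M * M\<close> is the squared norm of
  column j of \<open>M\<close>.\<close>

lemma mat_adjoint_mult_self_eq_zero:
  fixes M :: "complex mat"
  assumes M: "M \<in> carrier_mat m n" and z: "mat_adjoint M * M = 0\<^sub>m n n"
  shows "M = 0\<^sub>m m n"
proof (rule eq_matI)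
  fix i j assume "i < dim_row (0\<^sub>m m n)" "j < dim_col (0\<^sub>m m n)"
  then have i: "i < m" and j: "j < n" by auto
  have "(\<Sum>i = 0..<m. cnj (M $$ (i, j)) * M $$ (i, j)) = (mat_adjoint M * M) $$ (j, j)"
    using M j by (simp add: scalar_prod_def)
  then have "Re (\<Sum>i = 0..<m. cnj (M $$ (i, j)) * M $$ (i, j)) = 0"
    using z j by simp
  then have "(\<Sum>i = 0..<m. (cmod (M $$ (i, j)))\<^sup>2) = 0"
    by (simp add: cmod_def power2_eq_square)
  then show "M $$ (i, j) = 0\<^sub>m m n $$ (i, j)"
    using i j by (simp add: sum_nonneg_eq_0_iff)
qed (use M in auto)

text \<open>Multiplying the hypothesis on the left by \<open>mat_adjoint Z\<close> makes the Gram
  matrix of \<open>A * Z\<close> vanish.\<close>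

lemma mat_adjoint_self_mult_cancel:
  fixes A Z :: "complex mat"
  assumes A: "A \<in> carrier_mat m n" and Z: "Z \<in> carrier_mat n p"
    and z: "mat_adjoint A * (A * Z) = 0\<^sub>m n p"
  shows "A * Z = 0\<^sub>m m p"
proof (rule mat_adjoint_mult_self_eq_zero)
  have "mat_adjoint (A * Z) * (A * Z) = mat_adjoint Z * (mat_adjoint A * (A * Z))"
    using A Z by (simp add: mat_adjoint_mult_dim mult_mat_assoc)
  also have "\<dots> = 0\<^sub>m p p"
    unfolding z using Z by (simp add: right_mult_zero_mat[of _ p n])
  finally show "mat_adjoint (A * Z) * (A * Z) = 0\<^sub>m p p" .
qed (use A Z in auto)

lemma mat_adjoint_pow:
  fixes A :: "complex mat"
  assumes A: "A \<in> carrier_mat n n"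
  shows "mat_adjoint (A ^\<^sub>m k) = mat_adjoint A ^\<^sub>m k"
proof (induction k)
  case (Suc k)
  have "mat_adjoint (A ^\<^sub>m Suc k) = mat_adjoint A * mat_adjoint A ^\<^sub>m k"
    using A Suc by (simp add: mat_adjoint_mult_dim)
  also have "\<dots> = mat_adjoint A ^\<^sub>m Suc k"
    using A by (intro pow_mat_Suc_left[symmetric, of _ n]) auto
  finally show ?case .
qed (use A in simp)

text \<open>The adjoint reverses products, and the Drazin equations survive reversal because
  \<open>A\<close> and \<open>X\<close> commute. With uniqueness, Hermitian matrices get Hermitian
  Drazin inverses.\<close>

lemma is_drazin_mat_adjoint:
  assumes A: "A \<in> carrier_mat n n" and X: "is_drazin A X"
  shows "is_drazin (mat_adjoint A) (mat_adjoint X)"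
proof -
  have Xc: "X \<in> carrier_mat n n" and c: "A * X = X * A" and o: "X * A * X = X"
    using X A by (auto simp: is_drazin_def)
  obtain k where k: "A ^\<^sub>m Suc k * X = A ^\<^sub>m k"
    using X unfolding is_drazin_def by blast
  have "mat_adjoint A * mat_adjoint X = mat_adjoint X * mat_adjoint A"
    using arg_cong[OF c, of mat_adjoint] A Xc by (simp add: mat_adjoint_mult_dim)
  moreover have "mat_adjoint X * mat_adjoint A * mat_adjoint X = mat_adjoint X"
    using arg_cong[OF o, of mat_adjoint] A Xc by (simp add: mat_adjoint_mult_dim mult_mat_assoc)
  moreover have "mat_adjoint A ^\<^sub>m Suc k * mat_adjoint X = mat_adjoint A ^\<^sub>m k"
    using arg_cong[OF k[unfolded pow_mat_commute[OF A Xc c]], of mat_adjoint] A Xc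
    by (simp add: mat_adjoint_mult_dim mat_adjoint_pow del: pow_mat.simps)
  ultimately show ?thesis
    using A Xc unfolding is_drazin_def by auto
qed

text \<open>For \<open>H = A\<^sup>* A\<close> the cancellation \<open>H\<^sup>* H Z = 0 \<Longrightarrow> H Z = 0\<close> brings the exponent in the
  Drazin identity down to 1, and then \<open>H\<^sup>d A\<^sup>*\<close> is the Moore-Penrose inverse.\<close>
lemma is_moore_penrose_moore_penrose:
  fixes A :: "complex mat"
  shows "is_moore_penrose A (moore_penrose A)"
proof -
  define m n H where "m = dim_row A" and "n = dim_col A" and "H = mat_adjoint A * A"
  have A [simp]: "dim_row A = m" "dim_col A = n" by (auto simp: m_def n_def)
  have A': "A \<in> carrier_mat m n" by auto
  have H [simp]: "dim_row H = n" "dim_col H = n" and Hc: "H \<in> carrier_mat n n"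
    by (auto simp: H_def)
  have Hh: "mat_adjoint H = H" by (simp add: H_def mat_adjoint_mult_dim)
  define D where "D = drazin H"
  have D: "is_drazin H D" unfolding D_def by (rule is_drazin_drazin[OF Hc])
  then have Dc: "D \<in> carrier_mat n n" and c: "H * D = D * H" and o: "D * H * D = D"
    by (auto simp: is_drazin_def)
  have Dd [simp]: "dim_row D = n" "dim_col D = n" using Dc by auto
  obtain k where k: "H ^\<^sub>m Suc k * D = H ^\<^sub>m k"
    using D unfolding is_drazin_def by blast
  have Dh: "mat_adjoint D = D"
    using is_drazin_unique[OF _ is_drazin_mat_adjoint[OF Hc D, unfolded Hh] D] by simp
  \<comment> \<open>In terms of \<open>Z\<close> the Drazin identity reads
    \<open>H ^\<^sub>m k * Z = 0\<^sub>m n n\<close>, a form to which cancellation applies.\<close>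
  define Z where "Z = H * D - 1\<^sub>m n"
  have Zc: "Z \<in> carrier_mat n n" unfolding Z_def by (rule minus_carrier_mat) simp
  have Zd [simp]: "dim_row Z = n" "dim_col Z = n" using Zc by auto
  note comm = pow_mat_Suc_left[OF Hc]
  have HSZ: "H ^\<^sub>m Suc j * Z = 0\<^sub>m n n" if "H ^\<^sub>m j * Z = 0\<^sub>m n n" for j
    using that unfolding comm by (simp add: mult_mat_assoc right_mult_zero_mat[OF Hc])
  have Hk: "H ^\<^sub>m k \<in> carrier_mat n n" by (rule pow_carrier_mat[OF Hc])
  have "H ^\<^sub>m k * Z = H ^\<^sub>m k * (H * D) - H ^\<^sub>m k * 1\<^sub>m n"
    unfolding Z_def by (rule mult_minus_distrib_mat[OF Hk]) auto
  also have "H ^\<^sub>m k * (H * D) = H ^\<^sub>m Suc k * D"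
    by (simp add: mult_mat_assoc)
  finally have "H ^\<^sub>m k * Z = 0\<^sub>m n n"
    unfolding k using Hk by auto
  \<comment> \<open>As \<open>k\<close> may be 0, the exponent is first raised so that the descent
    can always end at 1.\<close>
  then have "H ^\<^sub>m Suc k * Z = 0\<^sub>m n n" by (rule HSZ)
  then have "H ^\<^sub>m 1 * Z = 0\<^sub>m n n"
  proof (induction k)
    case (Suc k)
    \<comment> \<open>Since \<open>H\<close> is Hermitian, its leftmost copy counts as
      \<open>mat_adjoint H\<close>, and cancelling it lowers the exponent by one.\<close>
    have "mat_adjoint H * (H * (H ^\<^sub>m k * Z)) = 0\<^sub>m n n"
      using Suc.prems unfolding Hh comm by (simp add: mult_mat_assoc)
    moreover have "H ^\<^sub>m k * Z \<in> carrier_mat n n"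
      by (rule mult_carrier_mat[OF pow_carrier_mat[OF Hc] Zc])
    ultimately have "H * (H ^\<^sub>m k * Z) = 0\<^sub>m n n"
      using mat_adjoint_self_mult_cancel[OF Hc] by blast
    then have "H ^\<^sub>m Suc k * Z = 0\<^sub>m n n" unfolding comm by (simp add: mult_mat_assoc)
    then show ?case by (rule Suc.IH)
  qed simp
  \<comment> \<open>A last cancellation, now for \<open>A\<close> itself, yields
    \<open>A * (H * D) = A\<close>, the source of the first Penrose equation.\<close>
  then have "mat_adjoint A * (A * Z) = 0\<^sub>m n n"
    by (simp add: H_def mult_mat_assoc)
  then have AZ: "A * Z = 0\<^sub>m m n"
    by (rule mat_adjoint_self_mult_cancel[OF A' Zc])
  have "A * Z = A * (H * D) - A"
    unfolding Z_def by (subst mult_minus_distrib_mat[OF A']) (use A' in auto)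
  with AZ have AHD: "A * (H * D) = A"
    using A' by (intro eq_matI) (auto simp: mat_eq_iff)
  have "is_moore_penrose A (D * mat_adjoint A)"
    unfolding is_moore_penrose_def
  proof (intro conjI)
    show "A * (D * mat_adjoint A) * A = A"
      using AHD c by (simp add: mult_mat_assoc flip: H_def)
    show "D * mat_adjoint A * A * (D * mat_adjoint A) = D * mat_adjoint A"
    proof -
      have "D * mat_adjoint A * A * (D * mat_adjoint A) = D * H * D * mat_adjoint A"
        by (simp add: H_def mult_mat_assoc)
      then show ?thesis using o by simp
    qed
    show "mat_adjoint (A * (D * mat_adjoint A)) = A * (D * mat_adjoint A)"
      by (simp add: mat_adjoint_mult_dim Dh mult_mat_assoc)
    have DA: "D * mat_adjoint A * A = D * H" by (simp add: H_def mult_mat_assoc)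
    show "mat_adjoint (D * mat_adjoint A * A) = D * mat_adjoint A * A"
      unfolding DA by (simp add: mat_adjoint_mult_dim Dh Hh c)
  qed auto
  then show ?thesis using moore_penrose_eqI by simp
qed

lemma moore_penrose_dim [simp]:
  "dim_row (moore_penrose A) = dim_col A" "dim_col (moore_penrose A) = dim_row A"
  using is_moore_penrose_moore_penrose[of A] by (auto simp: is_moore_penrose_def)

text \<open>The inner factors \<open>mat_adjoint E * E\<close> and \<open>W * mat_adjoint W\<close>
  cancel in every product, which reduces the Penrose equations to those of \<open>S\<close>. The
  first form serves \<open>A\<close>, the second the MPDMP matrix.\<close>

lemma moore_penrose_isometry_mult:
  fixes E W S :: "complex mat"
  assumes E: "E \<in> carrier_mat n r" and W: "W \<in> carrier_mat r n" and S: "S \<in> carrier_mat r r"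
    and EE: "mat_adjoint E * E = 1\<^sub>m r" and WW: "W * mat_adjoint W = 1\<^sub>m r"
  shows "moore_penrose (E * (S * W)) = mat_adjoint W * (moore_penrose S * mat_adjoint E)"
    and "moore_penrose (mat_adjoint W * (S * mat_adjoint E)) = E * (moore_penrose S * W)"
proof -
  have [simp]: "dim_row E = n" "dim_col E = r" "dim_row W = r" "dim_col W = n"
    "dim_row S = r" "dim_col S = r" using E W S by auto
  have E1: "mat_adjoint E * (E * Z) = Z" if "dim_row Z = r" for Z
  proof -
    have "mat_adjoint E * (E * Z) = mat_adjoint E * E * Z" using that by (simp add: mult_mat_assoc)
    then show ?thesis unfolding EE using that by simp
  qed
  have W1: "W * (mat_adjoint W * Z) = Z" if "dim_row Z = r" for Z
  proof -
    have "W * (mat_adjoint W * Z) = W * mat_adjoint W * Z" using that by (simp add: mult_mat_assoc)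
    then show ?thesis unfolding WW using that by simp
  qed
  define T where "T = moore_penrose S"
  have [simp]: "dim_row T = r" "dim_col T = r" by (auto simp: T_def)
  have T: "S * T * S = S" "T * S * T = T" "mat_adjoint (S * T) = S * T" "mat_adjoint (T * S) = T * S"
    using is_moore_penrose_moore_penrose[of S] by (auto simp: is_moore_penrose_def T_def)
  have S1: "S * (T * (S * Z)) = S * Z" "T * (S * (T * Z)) = T * Z" if "dim_row Z = r" for Z
    using that T(1,2) by (simp_all flip: mult_mat_assoc)
  have ad: "mat_adjoint T * mat_adjoint S = S * T" "mat_adjoint S * mat_adjoint T = T * S"
    using T(3,4) by (auto simp: mat_adjoint_mult_dim)
  have ad1: "mat_adjoint T * (mat_adjoint S * Z) = S * (T * Z)"
    "mat_adjoint S * (mat_adjoint T * Z) = T * (S * Z)" if "dim_row Z = r" for Z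
    using that ad by (simp_all flip: mult_mat_assoc)
  have "is_moore_penrose (E * (S * W)) (mat_adjoint W * (T * mat_adjoint E))"
    unfolding is_moore_penrose_def
    by (auto simp: mult_mat_assoc E1 W1 S1 mat_adjoint_mult_dim ad1)
  then show "moore_penrose (E * (S * W)) = mat_adjoint W * (moore_penrose S * mat_adjoint E)"
    unfolding T_def by (rule moore_penrose_eqI)
  have "is_moore_penrose (mat_adjoint W * (S * mat_adjoint E)) (E * (T * W))"
    unfolding is_moore_penrose_def
    by (auto simp: mult_mat_assoc E1 W1 S1 mat_adjoint_mult_dim ad1)
  then show "moore_penrose (mat_adjoint W * (S * mat_adjoint E)) = E * (moore_penrose S * W)"
    unfolding T_def by (rule moore_penrose_eqI)
qed

section \<open>The MPDMP matrix\<close>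

text \<open>Positive scalars can be inverted block by block. The carrier is proved alongside because
  block multiplication in the induction step needs it.\<close>

lemma diag_block_scalar_inverse:
  assumes "\<forall>(s, k) \<in> set sks. s > 0 \<and> k > (0::nat)"
  shows "let S = diag_block_mat (map (\<lambda>(s, k). complex_of_real s \<cdot>\<^sub>m 1\<^sub>m k) sks);
             r = sum_list (map snd sks) in
    S \<in> carrier_mat r r \<and> (\<exists>T \<in> carrier_mat r r. S * T = 1\<^sub>m r \<and> T * S = 1\<^sub>m r)"
  using assms
proof (induction sks)
  case Nil
  show ?case by (auto simp: Let_def)
next
  case (Cons p sks)
  obtain s k where p: "p = (s, k)" by force
  define r S where "r = sum_list (map snd sks)"
    and "S = diag_block_mat (map (\<lambda>(s, k). complex_of_real s \<cdot>\<^sub>m 1\<^sub>m k) sks)"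
  obtain T where S: "S \<in> carrier_mat r r" and T: "T \<in> carrier_mat r r" "S * T = 1\<^sub>m r" "T * S = 1\<^sub>m r"
    using Cons unfolding Let_def r_def[symmetric] S_def[symmetric] by auto
  have s: "s > 0" using Cons.prems by (auto simp: p)
  define I where "I = (\<lambda>s. complex_of_real s \<cdot>\<^sub>m 1\<^sub>m k)"
  let ?D = "\<lambda>A B. four_block_mat A (0\<^sub>m k r) (0\<^sub>m r k) B"
  have I: "I s \<in> carrier_mat k k" "I (inverse s) \<in> carrier_mat k k"
    "I s * I (inverse s) = 1\<^sub>m k" "I (inverse s) * I s = 1\<^sub>m k"
    using s by (auto simp: I_def mult_smult_assoc_mat[of _ k k _ k] mult_smult_distrib[of _ k k _ k]
        intro!: eq_matI simp flip: of_real_mult)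
  have "?D (I s) S * ?D (I (inverse s)) T = 1\<^sub>m (k + r)"
    "?D (I (inverse s)) T * ?D (I s) S = 1\<^sub>m (k + r)"
    using I S T by (subst mult_four_block_mat[of _ k k _ r _ r _ _ k _ r]; auto)+
  moreover have "?D (I s) S \<in> carrier_mat (k + r) (k + r)" "?D (I (inverse s)) T \<in> carrier_mat (k + r) (k + r)"
    using I S T by auto
  moreover have "diag_block_mat (map (\<lambda>(s, k). complex_of_real s \<cdot>\<^sub>m 1\<^sub>m k) (p # sks)) = ?D (I s) S"
    using S by (simp add: p I_def S_def[symmetric] Let_def)
  moreover have "sum_list (map snd (p # sks)) = k + r" by (simp add: p r_def)
  ultimately show ?case unfolding Let_def by auto
qed

lemma singular_value_diag_invertible:
  assumes "is_singular_value_diag A r S"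
  obtains T where "S \<in> carrier_mat r r" "T \<in> carrier_mat r r" "S * T = 1\<^sub>m r" "T * S = 1\<^sub>m r"
  using assms diag_block_scalar_inverse unfolding is_singular_value_diag_def Let_def by blast

text \<open>The witnesses are \<open>E = U (I 0)\<^sup>T\<close> and \<open>W = (Q P) U\<^sup>*\<close>.\<close>
lemma hartwig_spindelboeck_factor:
  assumes U: "unitary_mat n U" and Q: "Q \<in> carrier_mat r r" and P: "P \<in> carrier_mat r (n - r)"
    and QP: "Q * mat_adjoint Q + P * mat_adjoint P = 1\<^sub>m r" and rn: "r \<le> n"
  obtains E W where "E \<in> carrier_mat n r" "W \<in> carrier_mat r n"
    "mat_adjoint E * E = 1\<^sub>m r" "W * mat_adjoint W = 1\<^sub>m r" "W * E = Q"
    "\<And>S. S \<in> carrier_mat r r \<Longrightarrow>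
      U * four_block_mat (S * Q) (S * P) (0\<^sub>m (n - r) r) (0\<^sub>m (n - r) (n - r)) * mat_adjoint U = E * (S * W)"
proof -
  define m where "m = n - r"
  have n: "n = r + m" using rn by (simp add: m_def)
  have Uc: "U \<in> carrier_mat n n" and UU: "mat_adjoint U * U = 1\<^sub>m n"
    using U by (auto simp: unitary_mat_def)
  have P': "P \<in> carrier_mat r m" using P by (simp add: m_def)
  \<comment> \<open>Empty blocks pad the 2-by-1 and 1-by-2 shapes, so that the block product rule
    applies; \<open>fb\<close> strips them again.\<close>
  define E0 :: "complex mat" where "E0 = four_block_mat (1\<^sub>m r) (0\<^sub>m r 0) (0\<^sub>m m r) (0\<^sub>m m 0)"
  define W0 where "W0 = four_block_mat Q P (0\<^sub>m 0 r) (0\<^sub>m 0 m)"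
  have [simp]: "dim_row E0 = n" "dim_col E0 = r" "dim_row W0 = r" "dim_col W0 = n"
    "dim_row U = n" "dim_col U = n"
    using Q P' Uc by (auto simp: E0_def W0_def n)
  have U1: "mat_adjoint U * (U * Z) = Z" if "dim_row Z = n" for Z
  proof -
    have "mat_adjoint U * (U * Z) = mat_adjoint U * U * Z" using that by (simp add: mult_mat_assoc)
    then show ?thesis unfolding UU using that by simp
  qed
  have fb: "four_block_mat M (0\<^sub>m r 0) (0\<^sub>m 0 r) (0\<^sub>m 0 0) = M" if "M \<in> carrier_mat r r" for M :: "complex mat"
    using that by (intro eq_matI) auto
  have EE: "mat_adjoint E0 * E0 = 1\<^sub>m r"
    unfolding E0_def by (subst mat_adjoint_four_block_mat[of _ r r _ 0 _ m], auto,
      subst mult_four_block_mat[of _ r r _ m _ 0 _ _ r _ 0], auto simp: fb)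
  \<comment> \<open>This product is \<open>Q * mat_adjoint Q + P * mat_adjoint P\<close>, the
    identity by \<open>QP\<close>.\<close>
  have WW: "W0 * mat_adjoint W0 = 1\<^sub>m r"
    unfolding W0_def using Q P' QP by (subst mat_adjoint_four_block_mat[of _ r r _ m _ 0], auto,
      subst mult_four_block_mat[of _ r r _ m _ 0 _ _ r _ 0], auto simp: fb)
  have WE: "W0 * E0 = Q"
    unfolding W0_def E0_def using Q P'
    by (subst mult_four_block_mat[of _ r r _ m _ 0 _ _ r _ 0], auto simp: fb)
  have ESW: "E0 * (S * W0) = four_block_mat (S * Q) (S * P) (0\<^sub>m m r) (0\<^sub>m m m)"
    if S: "S \<in> carrier_mat r r" for S
  proof -
    have "S * W0 = four_block_mat S (0\<^sub>m r 0) (0\<^sub>m 0 r) (0\<^sub>m 0 0) * W0"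
      using S by (simp add: fb)
    also have "\<dots> = four_block_mat (S * Q) (S * P) (0\<^sub>m 0 r) (0\<^sub>m 0 m)"
      unfolding W0_def using S Q P'
      by (subst mult_four_block_mat[of _ r r _ 0 _ 0 _ _ r _ m]) auto
    finally show ?thesis
      unfolding E0_def using S Q P'
      by (simp, subst mult_four_block_mat[of _ r r _ 0 _ m _ _ r _ m]) auto
  qed
  show ?thesis
  proof (rule that[of "U * E0" "W0 * mat_adjoint U"])
    show "mat_adjoint (U * E0) * (U * E0) = 1\<^sub>m r"
      by (simp add: mat_adjoint_mult_dim mult_mat_assoc U1 EE)
    show "W0 * mat_adjoint U * mat_adjoint (W0 * mat_adjoint U) = 1\<^sub>m r"
      by (simp add: mat_adjoint_mult_dim mult_mat_assoc U1 WW)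
    show "W0 * mat_adjoint U * (U * E0) = Q"
      by (simp add: mult_mat_assoc U1 WE)
    show "U * four_block_mat (S * Q) (S * P) (0\<^sub>m (n - r) r) (0\<^sub>m (n - r) (n - r)) * mat_adjoint U =
      U * E0 * (S * (W0 * mat_adjoint U))" if "S \<in> carrier_mat r r" for S
      using that ESW[OF that, symmetric] by (simp add: mult_mat_assoc flip: m_def)
  qed auto
qed

section \<open>The MPDMP matrix in factored form and its Moore-Penrose inverse\<close>

theorem theorem9:
  fixes n r :: nat and A U \<Sigma> Q P \<Sigma>' :: "complex mat"
  assumes "A \<in> carrier_mat n n"
    and "vec_space.rank n A = r"
    and "r > 0"
    and "hartwig_spindelboeck n r A U \<Sigma> Q P"
    and "\<Sigma>' = Q * drazin (\<Sigma> * Q) * (drazin (\<Sigma> * Q)) ^\<^sub>m 2"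
  shows "moore_penrose (mpdmp A) =
    U * four_block_mat (moore_penrose \<Sigma>' * Q) (moore_penrose \<Sigma>' * P)
                       (0\<^sub>m (n - r) r) (0\<^sub>m (n - r) (n - r)) * mat_adjoint U"
proof -
  have U: "unitary_mat n U" and S: "is_singular_value_diag A r \<Sigma>"
    and Q: "Q \<in> carrier_mat r r" and P: "P \<in> carrier_mat r (n - r)"
    and QP: "Q * mat_adjoint Q + P * mat_adjoint P = 1\<^sub>m r"
    and A: "A = U * four_block_mat (\<Sigma> * Q) (\<Sigma> * P) (0\<^sub>m (n - r) r) (0\<^sub>m (n - r) (n - r)) * mat_adjoint U"
    using assms(4) by (auto simp: hartwig_spindelboeck_def)
  \<comment> \<open>The bound keeps the truncated subtraction \<open>n - r\<close> honest: the block
    sizes add up to \<open>n\<close>.\<close>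
  have rn: "r \<le> n" using vec_space.rank_le_nc[OF assms(1)] assms(2) by simp
  obtain T where Sc: "\<Sigma> \<in> carrier_mat r r" and T: "T \<in> carrier_mat r r" "\<Sigma> * T = 1\<^sub>m r" "T * \<Sigma> = 1\<^sub>m r"
    using singular_value_diag_invertible[OF S] .
  \<comment> \<open>\<open>blk\<close> is kept for arbitrary \<open>S\<close>: it is applied to
    \<Sigma> to factor \<open>A\<close>, and at the end to
    \<open>moore_penrose \<Sigma>'\<close>.\<close>
  obtain E W where EW: "E \<in> carrier_mat n r" "W \<in> carrier_mat r n"
    "mat_adjoint E * E = 1\<^sub>m r" "W * mat_adjoint W = 1\<^sub>m r" "W * E = Q"
    and blk: "\<And>S. S \<in> carrier_mat r r \<Longrightarrow>
      U * four_block_mat (S * Q) (S * P) (0\<^sub>m (n - r) r) (0\<^sub>m (n - r) (n - r)) * mat_adjoint U = E * (S * W)"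
    using hartwig_spindelboeck_factor[OF U Q P QP rn] by metis
  have A': "A = E * (\<Sigma> * W)" unfolding A by (rule blk[OF Sc])
  define D where "D = drazin (\<Sigma> * Q)"
  have SQ: "\<Sigma> * Q \<in> carrier_mat r r" using Sc Q by auto
  have D: "is_drazin (\<Sigma> * Q) D" unfolding D_def by (rule is_drazin_drazin[OF SQ])
  then have Dc: "D \<in> carrier_mat r r" and c: "\<Sigma> * Q * D = D * (\<Sigma> * Q)" and o: "D * (\<Sigma> * Q) * D = D"
    using Sc Q by (auto simp: is_drazin_def)
  have [simp]: "dim_row E = n" "dim_col E = r" "dim_row W = r" "dim_col W = n"
    "dim_row \<Sigma> = r" "dim_col \<Sigma> = r" "dim_row T = r" "dim_col T = r" "dim_row Q = r" "dim_col Q = r"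
    "dim_row D = r" "dim_col D = r"
    using EW Sc T Q Dc by auto
  have "is_moore_penrose \<Sigma> T" using T by (auto simp: is_moore_penrose_def)
  then have mpA: "moore_penrose A = mat_adjoint W * (T * mat_adjoint E)"
    unfolding A' using moore_penrose_isometry_mult(1)[OF EW(1,2) Sc EW(3,4)] moore_penrose_eqI by simp
  \<comment> \<open>Cline's formula with the factors \<open>E\<close> and
    \<open>\<Sigma> * W\<close>, whose swapped product is \<open>\<Sigma> * Q\<close>.\<close>
  have "\<Sigma> * W * E = \<Sigma> * Q" using EW(5) by (simp add: mult_mat_assoc)
  then have "is_drazin A (E * (D * (D * (\<Sigma> * W))))"
    unfolding A' using D EW(2) Sc by (intro is_drazin_mult_swap[OF EW(1)]) auto
  then have dA: "drazin A = E * (D * (D * (\<Sigma> * W)))"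
    using assms(1) by (intro drazin_eqI) auto
  have c': "\<Sigma> * (Q * (D * Z)) = D * (\<Sigma> * (Q * Z))" if "dim_row Z = r" for Z
  proof -
    have "\<Sigma> * (Q * (D * Z)) = \<Sigma> * Q * D * Z" using that by (simp add: mult_mat_assoc)
    also have "\<dots> = D * (\<Sigma> * (Q * Z))" unfolding c using that by (simp add: mult_mat_assoc)
    finally show ?thesis .
  qed
  have S': "\<Sigma>' = Q * (D * (D * D))"
    unfolding assms(5) D_def[symmetric] by (simp add: numeral_2_eq_2 mult_mat_assoc)
  \<comment> \<open>One \<open>D\<close> is expanded by the outer inverse equation; commuting
    \<open>\<Sigma> * Q\<close> to the front lets \<open>T\<close> cancel \<Sigma>, which leaves
    \<open>Q\<close> times the cube of \<open>D\<close>.\<close>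
  have "T * (D * D) = T * (D * \<Sigma> * Q * D * D)"
    using o by (simp add: mult_mat_assoc)
  also have "\<dots> = T * \<Sigma> * (Q * (D * (D * D)))"
    by (simp add: mult_mat_assoc c')
  also have "\<dots> = \<Sigma>'" unfolding T(3) S' by simp
  finally have TDD: "T * (D * D) = \<Sigma>'" .
  have canc: "\<Sigma> * (T * Z) = Z" "mat_adjoint E * (E * Z) = Z" "W * (mat_adjoint W * Z) = Z"
    if "dim_row Z = r" for Z
    using that T(2) EW(3,4) by (simp_all flip: mult_mat_assoc)
  \<comment> \<open>Between the three factors \<open>mat_adjoint E * E\<close> and
    \<open>W * mat_adjoint W\<close> collapse, and then \<open>\<Sigma> * T\<close> does.\<close>
  have "mpdmp A = mat_adjoint W * (T * (D * D) * mat_adjoint E)"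
    unfolding mpdmp_def mpA dA by (simp add: mult_mat_assoc canc)
  then have "mpdmp A = mat_adjoint W * (\<Sigma>' * mat_adjoint E)" unfolding TDD .
  moreover have S'c: "\<Sigma>' \<in> carrier_mat r r" unfolding S' by auto
  ultimately have "moore_penrose (mpdmp A) = E * (moore_penrose \<Sigma>' * W)"
    using moore_penrose_isometry_mult(2)[OF EW(1,2) S'c EW(3,4)] by simp
  also have "\<dots> = U * four_block_mat (moore_penrose \<Sigma>' * Q) (moore_penrose \<Sigma>' * P)
                       (0\<^sub>m (n - r) r) (0\<^sub>m (n - r) (n - r)) * mat_adjoint U"
    by (rule blk[symmetric]) (use S'c in auto)
  finally show ?thesis .
qed

end
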